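(* Let $\mathbb{F}$ be any field and let $(A,[\cdot,\cdot],\sigma)$ be a finite-dimensional regular simple Hom-Lie algebra over $\mathbb{F}$. Then there exist an integer $n\ge 1$, a simple Lie algebra $(\mathfrak{s},[\cdot,\cdot]_{\mathfrak{s}})$ over $\mathbb{F}$, a vector space decomposition $A=\bigoplus_{i=1}^n\mathfrak{s}_i$, and Lie brackets $[\cdot,\cdot]_i$ on $\mathfrak{s}_i$ with $(\mathfrak{s}_i,[\cdot,\cdot]_i)\simeq(\mathfrak{s},[\cdot,\cdot]_{\mathfrak{s}})$ for $1\le i\le n$, such that $[\cdot,\cdot]=\sigma\circ\bigoplus_{i=1}^n[\cdot,\cdot]_i$, and the twisting map has the form $\sigma=\bigoplus_{i=1}^n\sigma_{i\rho(i)}$, where $\rho$ is a cyclic permutation of $\{1,\dots,n\}$ of length $n$ and each $\sigma_{i\rho(i)}=\sigma|_{\mathfrak{s}_i}:(\mathfrak{s}_i,[\cdot,\cdot]_i)\to(\mathfrak{s}_{\rho(i)},[\cdot,\cdot]_{\rho(i)})$ is an isomorphism of Lie algebras (an automorphism of $\mathfrak{s}$ after identifying the copies with $\mathfrak{s}$).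
   Context: An anticommutative algebra is a vector space with a bilinear product $[\cdot,\cdot]$ satisfying $[x,x]=0$ for all $x$. A Hom-Lie algebra is a triple $(A,[\cdot,\cdot],\sigma)$ with $(A,[\cdot,\cdot])$ an anticommutative algebra and $\sigma:A\to A$ linear (the twisting map) with $[\sigma(x),[y,z]]+[\sigma(y),[z,x]]+[\sigma(z),[x,y]]=0$ for all $x,y,z$. It is regular if $\sigma$ is an automorphism of the algebra $(A,[\cdot,\cdot])$. A Hom-ideal is a subspace $I$ with $[I,A]\subset I$ and $\sigma(I)\subset I$; a Hom-Lie algebra is simple if it is not abelian (its product is nonzero) and its only Hom-ideals are $0$ and $A$. A Lie algebra is simple if it is not abelian and its only ideals are $0$ and itself. Here $\bigoplus_{i}[\cdot,\cdot]_i$ denotes the direct sum Lie bracket on $\bigoplus_i\mathfrak{s}_i$ (distinct summands commute). *)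

theory Defs
  imports Complex_Main "HOL-Combinatorics.Orbits"
begin

text \<open>
  Algebras are given by a carrier (a subspace of an ambient vector space) and a bracket that only
  matters on the carrier, so that one set of notions serves both an algebra \<open>A\<close> on the whole
  ambient space and the summands in a decomposition of \<open>A\<close>.
\<close>

definition linear_on ::
  "('f \<Rightarrow> 'a \<Rightarrow> 'a) \<Rightarrow> 'a set \<Rightarrow> 'a set \<Rightarrow> ('a::ab_group_add \<Rightarrow> 'a) \<Rightarrow> bool" where
  "linear_on scale S T f \<longleftrightarrow>
     f \<in> S \<rightarrow> T \<and>
     (\<forall>x\<in>S. \<forall>y\<in>S. f (x + y) = f x + f y) \<and>
     (\<forall>c. \<forall>x\<in>S. f (scale c x) = scale c (f x))"

definition algebra_iso ::
  "('f \<Rightarrow> 'a \<Rightarrow> 'a) \<Rightarrow> 'a set \<Rightarrow> ('a \<Rightarrow> 'a \<Rightarrow> 'a) \<Rightarrow> 'a set \<Rightarrow> ('a \<Rightarrow> 'a \<Rightarrow> 'a)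
     \<Rightarrow> ('a::ab_group_add \<Rightarrow> 'a) \<Rightarrow> bool" where
  "algebra_iso scale S brS T brT f \<longleftrightarrow>
     linear_on scale S T f \<and> bij_betw f S T \<and>
     (\<forall>x\<in>S. \<forall>y\<in>S. f (brS x y) = brT (f x) (f y))"

locale anticommutative_algebra = vector_space scale
  for scale :: "'f::field \<Rightarrow> 'a::ab_group_add \<Rightarrow> 'a" +
  fixes A :: "'a set" and bracket :: "'a \<Rightarrow> 'a \<Rightarrow> 'a"
  assumes subspace_carrier: "subspace A"
    and linear_left: "y \<in> A \<Longrightarrow> linear_on scale A A (\<lambda>x. bracket x y)"
    and linear_right: "x \<in> A \<Longrightarrow> linear_on scale A A (\<lambda>y. bracket x y)"
    and bracket_self: "x \<in> A \<Longrightarrow> bracket x x = 0"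
begin

definition abelian :: bool where
  "abelian \<longleftrightarrow> (\<forall>x\<in>A. \<forall>y\<in>A. bracket x y = 0)"

text \<open>By anticommutativity one-sided absorption suffices.\<close>

definition algebra_ideal :: "'a set \<Rightarrow> bool" where
  "algebra_ideal I \<longleftrightarrow> subspace I \<and> I \<subseteq> A \<and> (\<forall>x\<in>I. \<forall>y\<in>A. bracket x y \<in> I)"

end

locale lie_algebra = anticommutative_algebra +
  assumes jacobi: "x \<in> A \<Longrightarrow> y \<in> A \<Longrightarrow> z \<in> A \<Longrightarrow>
    bracket x (bracket y z) + bracket y (bracket z x) + bracket z (bracket x y) = 0"

locale simple_lie_algebra = lie_algebra +
  assumes not_abelian: "\<not> abelian"
    and ideal_trivial: "algebra_ideal I \<Longrightarrow> I = {0} \<or> I = A"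

locale hom_lie_algebra = anticommutative_algebra scale A bracket
  for scale :: "'f::field \<Rightarrow> 'a::ab_group_add \<Rightarrow> 'a" and A bracket +
  fixes \<sigma> :: "'a \<Rightarrow> 'a"
  assumes linear_twist: "linear_on scale A A \<sigma>"
    and hom_jacobi: "x \<in> A \<Longrightarrow> y \<in> A \<Longrightarrow> z \<in> A \<Longrightarrow>
      bracket (\<sigma> x) (bracket y z) + bracket (\<sigma> y) (bracket z x) + bracket (\<sigma> z) (bracket x y) = 0"
begin

definition hom_ideal :: "'a set \<Rightarrow> bool" where
  "hom_ideal I \<longleftrightarrow> algebra_ideal I \<and> \<sigma> ` I \<subseteq> I"

end

locale regular_hom_lie_algebra = hom_lie_algebra +
  assumes twist_automorphism: "algebra_iso scale A bracket A bracket \<sigma>"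

locale simple_hom_lie_algebra = hom_lie_algebra +
  assumes not_abelian: "\<not> abelian"
    and hom_ideal_trivial: "hom_ideal I \<Longrightarrow> I = {0} \<or> I = A"

text \<open>
  An internal direct sum: the canonical map from the external direct sum, realised as the
  extensional families \<open>f\<close> with \<open>f i \<in> S i\<close>, is a bijection onto \<open>A\<close>. The index set is meant to be
  finite.
\<close>

definition is_direct_sum ::
  "('f::field \<Rightarrow> 'a::ab_group_add \<Rightarrow> 'a) \<Rightarrow> 'i set \<Rightarrow> ('i \<Rightarrow> 'a set) \<Rightarrow> 'a set \<Rightarrow> bool" where
  "is_direct_sum scale I S A \<longleftrightarrow>
     (\<forall>i\<in>I. module.subspace scale (S i)) \<and>
     bij_betw (\<lambda>f. \<Sum>i\<in>I. f i) (\<Pi>\<^sub>E i\<in>I. S i) A"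

definition component :: "'i set \<Rightarrow> ('i \<Rightarrow> 'a::ab_group_add set) \<Rightarrow> 'i \<Rightarrow> 'a \<Rightarrow> 'a" where
  "component I S i x = inv_into (\<Pi>\<^sub>E i\<in>I. S i) (\<lambda>f. \<Sum>i\<in>I. f i) x i"

definition direct_sum_bracket ::
  "'i set \<Rightarrow> ('i \<Rightarrow> 'a::ab_group_add set) \<Rightarrow> ('i \<Rightarrow> 'a \<Rightarrow> 'a \<Rightarrow> 'a) \<Rightarrow> 'a \<Rightarrow> 'a \<Rightarrow> 'a" where
  "direct_sum_bracket I S br x y = (\<Sum>i\<in>I. br i (component I S i x) (component I S i y))"

definition direct_sum_map ::
  "'i set \<Rightarrow> ('i \<Rightarrow> 'a::ab_group_add set) \<Rightarrow> ('i \<Rightarrow> 'a \<Rightarrow> 'a) \<Rightarrow> 'a \<Rightarrow> 'a" where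
  "direct_sum_map I S g x = (\<Sum>i\<in>I. g i (component I S i x))"

end

theory Submission
  imports Defs
begin

text \<open>
  Following Yau's trick, \<open>\<sigma>\<inverse> \<circ> [\<cdot>,\<cdot>]\<close> is a Lie bracket on \<open>A\<close>, \<open>\<sigma>\<close> is an automorphism of it, and
  its \<open>\<sigma>\<close>-stable ideals are Hom-ideals; so its centre is trivial. Let \<open>M\<close> be a minimal ideal of
  this Lie algebra. The sum of the translates \<open>\<sigma>\<^sup>k M\<close> is a \<open>\<sigma>\<close>-stable ideal, hence all of \<open>A\<close>.
  Distinct translates are distinct minimal ideals, so they commute. As the centre is trivial,
  \<open>M\<close> is simple and the sum of the distinct translates is direct. By finite dimension the sequence
  \<open>\<sigma>\<^sup>k M\<close> is periodic, and \<open>\<sigma>\<close> permutes its members cyclically.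
\<close>

section \<open>Isomorphisms and direct sums\<close>

text \<open>Needed to pass from \<open>\<sigma>\<close> to its restriction to a summand. The algebra
  hypothesis keeps sums, multiples and products inside \<open>S\<close>, where \<open>f\<close> and
  \<open>g\<close> agree.\<close>

lemma algebra_iso_cong:
  assumes "algebra_iso scale S brS T brT f" "\<And>x. x \<in> S \<Longrightarrow> f x = g x"
    and "anticommutative_algebra scale S brS"
  shows "algebra_iso scale S brS T brT g"
proof -
  interpret anticommutative_algebra scale S brS by fact
  have closed: "x + y \<in> S" "scale c x \<in> S" "brS x y \<in> S" if "x \<in> S" "y \<in> S" for x y c
    using that subspace_carrier linear_left[of y]
    by (auto simp: subspace_add subspace_scale linear_on_def)
  have "bij_betw g S T"
    using assms(1,2) bij_betw_cong[of S f g T] by (simp add: algebra_iso_def)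
  then show ?thesis
    using assms(1,2) closed unfolding algebra_iso_def linear_on_def
    by (simp add: Pi_iff)
qed

lemma algebra_iso_comp:
  assumes "algebra_iso scale S brS T brT f" "algebra_iso scale T brT U brU g"
  shows "algebra_iso scale S brS U brU (g \<circ> f)"
proof -
  have "f x \<in> T" if "x \<in> S" for x
    using assms(1) that by (auto simp: algebra_iso_def linear_on_def)
  then show ?thesis
    using assms bij_betw_trans[of f S T g U]
    unfolding algebra_iso_def linear_on_def by (simp add: Pi_iff)
qed

lemma algebra_iso_inv_into:
  assumes iso: "algebra_iso scale S brS T brT f" and "anticommutative_algebra scale S brS"
  shows "algebra_iso scale T brT S brS (inv_into S f)"
proof -
  interpret anticommutative_algebra scale S brS by fact
  let ?g = "inv_into S f"
  have closed: "x + y \<in> S" "scale c x \<in> S" "brS x y \<in> S" if "x \<in> S" "y \<in> S" for x y c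
    using that subspace_carrier linear_left[of y]
    by (auto simp: subspace_add subspace_scale linear_on_def)
  have bij: "bij_betw f S T"
    and add: "\<And>x y. x \<in> S \<Longrightarrow> y \<in> S \<Longrightarrow> f (x + y) = f x + f y"
    and scl: "\<And>c x. x \<in> S \<Longrightarrow> f (scale c x) = scale c (f x)"
    and hom: "\<And>x y. x \<in> S \<Longrightarrow> y \<in> S \<Longrightarrow> f (brS x y) = brT (f x) (f y)"
    using iso by (auto simp: algebra_iso_def linear_on_def)
  have g: "?g y \<in> S" "f (?g y) = y" if "y \<in> T" for y
    using bij that by (auto simp: bij_betw_def f_inv_into_f inv_into_into)
  have gI: "?g y = x" if "x \<in> S" "f x = y" for x y
    using bij that by (auto simp: bij_betw_def)
  have "?g (x + y) = ?g x + ?g y" "?g (scale c x) = scale c (?g x)"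
    "?g (brT x y) = brS (?g x) (?g y)" if "x \<in> T" "y \<in> T" for x y c
    using that closed[OF g(1) g(1)] by (auto intro!: gI simp: g add scl hom)
  then show ?thesis
    using g bij_betw_inv_into[OF bij] by (auto simp: algebra_iso_def linear_on_def)
qed

lemma algebra_iso_image:
  assumes "algebra_iso scale UNIV br UNIV br f"
  shows "algebra_iso scale T br (f ` T) br f"
  using assms by (auto simp: algebra_iso_def linear_on_def bij_betw_def inj_on_def)

lemma algebra_iso_funpow:
  assumes "algebra_iso scale UNIV br UNIV br f"
  shows "algebra_iso scale UNIV br UNIV br (f ^^ k)"
proof (induction k)
  case 0
  show ?case by (simp add: algebra_iso_def linear_on_def bij_betw_def)
next
  case (Suc k)
  then show ?case by (simp only: funpow.simps algebra_iso_comp[OF _ assms])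
qed

section \<open>Internal direct sums and the cyclic shift of the indices\<close>

lemma component_mem_sum:
  assumes "is_direct_sum scale I S UNIV"
  shows "i \<in> I \<Longrightarrow> component I S i x \<in> S i" and "(\<Sum>i\<in>I. component I S i x) = x"
proof -
  let ?sum = "\<lambda>f. \<Sum>i\<in>I. f i"
  have *: "x \<in> ?sum ` (\<Pi>\<^sub>E i\<in>I. S i)"
    using assms by (auto simp: is_direct_sum_def bij_betw_def)
  show "i \<in> I \<Longrightarrow> component I S i x \<in> S i"
    using inv_into_into[OF *] by (auto simp: component_def)
  show "(\<Sum>i\<in>I. component I S i x) = x"
    using f_inv_into_f[OF *] by (simp add: component_def)
qed

text \<open>Independence applied to differences gives injectivity of the summation map; its image is
  a subspace containing every \<open>S i\<close>, hence contains their span.\<close>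

lemma (in vector_space) is_direct_sumI:
  assumes fin: "finite I" and sub: "\<And>i. i \<in> I \<Longrightarrow> subspace (S i)"
    and span: "span (\<Union>i\<in>I. S i) = UNIV"
    and indep: "\<And>d i. (\<And>i. i \<in> I \<Longrightarrow> d i \<in> S i) \<Longrightarrow> (\<Sum>i\<in>I. d i) = 0 \<Longrightarrow> i \<in> I \<Longrightarrow> d i = 0"
  shows "is_direct_sum scale I S UNIV"
proof -
  let ?sum = "\<lambda>f. \<Sum>i\<in>I. f i" and ?P = "\<Pi>\<^sub>E i\<in>I. S i"
  have "inj_on ?sum ?P"
  proof (rule inj_onI)
    fix f g assume f: "f \<in> ?P" and g: "g \<in> ?P" and eq: "?sum f = ?sum g"
    have "f i - g i = 0" if "i \<in> I" for i
      using f g eq that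
      by (intro indep[of "\<lambda>i. f i - g i"]) (auto simp: sum_subtractf intro!: subspace_diff sub)
    then show "f = g"
      using f g by (intro PiE_ext) auto
  qed
  moreover have "x \<in> ?sum ` ?P" for x
  proof -
    \<comment> \<open>Restricting to \<open>I\<close> makes the family extensional without changing
      its sum, so later witnesses can be given as plain functions.\<close>
    have mem: "?sum f \<in> ?sum ` ?P" if "\<And>i. i \<in> I \<Longrightarrow> f i \<in> S i" for f
      using that by (intro image_eqI[of _ _ "restrict f I"]) auto
    have "subspace (?sum ` ?P)"
    proof (rule subspaceI)
      show "0 \<in> ?sum ` ?P"
        using mem[of "\<lambda>_. 0"] sub by (simp add: subspace_0)
    next
      fix x y assume "x \<in> ?sum ` ?P" "y \<in> ?sum ` ?P"
      then obtain f g where "f \<in> ?P" "g \<in> ?P" "x = ?sum f" "y = ?sum g" by auto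
      then show "x + y \<in> ?sum ` ?P"
        using mem[of "\<lambda>i. f i + g i"] sub by (auto simp: sum.distrib subspace_add PiE_mem)
    next
      fix c x assume "x \<in> ?sum ` ?P"
      then obtain f where "f \<in> ?P" "x = ?sum f" by auto
      then show "scale c x \<in> ?sum ` ?P"
        using mem[of "\<lambda>i. scale c (f i)"] sub
        by (auto simp: scale_sum_right subspace_scale PiE_mem)
    qed
    moreover have "S i \<subseteq> ?sum ` ?P" if "i \<in> I" for i
    proof
      fix y assume "y \<in> S i"
      then show "y \<in> ?sum ` ?P"
        using mem[of "\<lambda>j. if j = i then y else 0"] that fin sub by (auto simp: subspace_0)
    qed
    ultimately have "span (\<Union>i\<in>I. S i) \<subseteq> ?sum ` ?P"
      by (intro span_minimal) auto
    then show ?thesis using span by auto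
  qed
  ultimately show ?thesis
    using sub by (auto simp: is_direct_sum_def bij_betw_def)
qed

lemma cyclic_permutation_atLeastAtMost:
  fixes n :: nat
  assumes "n \<ge> 1"
  defines "\<rho> \<equiv> \<lambda>i. if i \<in> {1..<n} then Suc i else if i = n then 1 else i"
  shows "\<rho> permutes {1..n}" and "cyclic_on \<rho> {1..n}"
proof -
  show perm: "\<rho> permutes {1..n}"
    by (rule inj_imp_permutes) (use assms in \<open>auto simp: inj_on_def split: if_splits\<close>)
  \<comment> \<open>The orbit is started at \<open>n\<close>: its first member is then
    \<open>\<rho> n = 1\<close>, and each further application of \<open>\<rho>\<close> adds the
    successor.\<close>
  have "k \<in> {1..n} \<Longrightarrow> k \<in> orbit \<rho> n" for k
  proof (induction k)
    case (Suc k)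
    show ?case
    proof (cases "k = 0")
      case True
      then show ?thesis
        using orbit.base[of \<rho> n] by (simp add: \<rho>_def)
    next
      case False
      then have "Suc k = \<rho> k" "k \<in> orbit \<rho> n" using Suc by (auto simp: \<rho>_def)
      then show ?thesis by (metis orbit.step)
    qed
  qed simp
  moreover have "orbit \<rho> n \<subseteq> {1..n}"
    using permutes_orbit_subset[OF perm] assms by simp
  ultimately show "cyclic_on \<rho> {1..n}"
    using assms(1) by (auto simp: cyclic_on_def intro!: bexI[of _ n])
qed

section \<open>Ideals of Lie algebras\<close>

lemma (in lie_algebra) lie_algebra_ideal:
  assumes "algebra_ideal I"
  shows "lie_algebra scale I bracket"
proof -
  have sub: "subspace I" "I \<subseteq> A" and abs: "\<And>x y. x \<in> I \<Longrightarrow> y \<in> A \<Longrightarrow> bracket x y \<in> I"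
    using assms by (auto simp: algebra_ideal_def)
  show ?thesis
  proof (unfold_locales, goal_cases)
    case (2 y)
    then show ?case using sub abs linear_left[of y] by (auto simp: linear_on_def subset_iff)
  next
    case (3 x)
    then show ?case using sub abs linear_right[of x] by (auto simp: linear_on_def subset_iff)
  qed (use sub bracket_self jacobi in \<open>auto simp: subset_iff\<close>)
qed

section \<open>The untwisted Lie algebra\<close>

locale simple_regular_hom_lie_algebra =
  regular_hom_lie_algebra scale UNIV bracket \<sigma> + simple_hom_lie_algebra scale UNIV bracket \<sigma>
  for scale :: "'f::field \<Rightarrow> 'a::ab_group_add \<Rightarrow> 'a" and bracket \<sigma>
begin

definition untwisted :: "'a \<Rightarrow> 'a \<Rightarrow> 'a" where
  "untwisted x y = inv \<sigma> (bracket x y)"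

lemma bij_twist: "bij \<sigma>"
  and twist_add: "\<sigma> (x + y) = \<sigma> x + \<sigma> y"
  and twist_scale: "\<sigma> (scale c x) = scale c (\<sigma> x)"
  and twist_bracket: "\<sigma> (bracket x y) = bracket (\<sigma> x) (\<sigma> y)"
  using twist_automorphism by (auto simp: algebra_iso_def linear_on_def)

lemma twist_untwisted: "\<sigma> (untwisted x y) = bracket x y"
  using bij_twist by (simp add: untwisted_def bij_is_surj surj_f_inv_f)

lemma twist_eq_iff: "\<sigma> x = \<sigma> y \<longleftrightarrow> x = y"
  using bij_twist by (meson bij_is_inj inj_eq)

lemmas twist_eqD = twist_eq_iff[THEN iffD1]

lemma bracket_linear:
  "bracket (x + y) z = bracket x z + bracket y z" "bracket (scale c x) z = scale c (bracket x z)"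
  "bracket x (y + z) = bracket x y + bracket x z" "bracket x (scale c z) = scale c (bracket x z)"
  using linear_left[of z] linear_right[of x] by (auto simp: linear_on_def)

text \<open>Since \<open>\<sigma>\<close> is multiplicative for \<open>bracket\<close>, both sides
  of the homomorphism law have the same image under the injective \<open>\<sigma>\<close>.\<close>

lemma twist_automorphism_untwisted: "algebra_iso scale UNIV untwisted UNIV untwisted \<sigma>"
  using bij_twist twist_bracket
  by (simp add: algebra_iso_def linear_on_def twist_add twist_scale)
     (metis twist_untwisted twist_eq_iff)

text \<open>Every identity is checked after applying the injective \<open>\<sigma>\<close>, which
  turns an outer \<open>untwisted\<close> into \<open>bracket\<close>.\<close>

sublocale untw: lie_algebra scale UNIV untwisted
proof unfold_locales
  have *: "untwisted (x + y) z = untwisted x z + untwisted y z"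
    "untwisted (scale c x) z = scale c (untwisted x z)"
    "untwisted x (y + z) = untwisted x y + untwisted x z"
    "untwisted x (scale c z) = scale c (untwisted x z)" for x y z c
    by (rule twist_eqD, simp add: twist_untwisted twist_add twist_scale bracket_linear)+
  show "linear_on scale UNIV UNIV (\<lambda>x. untwisted x y)"
    "linear_on scale UNIV UNIV (\<lambda>x. untwisted y x)" for y
    by (simp_all add: linear_on_def *)
  have twist_0: "\<sigma> 0 = 0"
    using twist_add[of 0 0] by simp
  show "untwisted x x = 0" for x
    by (rule twist_eqD) (simp add: twist_untwisted twist_0 bracket_self)
  \<comment> \<open>The first \<open>\<sigma>\<close> removes the outer inverse, the second passes
    into the product and removes the inner one. What remains is a term of the Hom-Jacobi
    identity.\<close>
  have "\<sigma> (\<sigma> (untwisted x (untwisted y z))) = bracket (\<sigma> x) (bracket y z)" for x y z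
    by (simp add: twist_untwisted twist_bracket)
  then have "\<sigma> (\<sigma> (untwisted x (untwisted y z) + untwisted y (untwisted z x)
      + untwisted z (untwisted x y))) = \<sigma> (\<sigma> 0)" for x y z
    using hom_jacobi[of x y z] by (simp add: twist_add twist_0)
  then show "untwisted x (untwisted y z) + untwisted y (untwisted z x)
      + untwisted z (untwisted x y) = 0" for x y z
    by (simp add: twist_eq_iff)
qed simp

lemma untwisted_linear:
  "untwisted (x + y) z = untwisted x z + untwisted y z"
  "untwisted (scale c x) z = scale c (untwisted x z)"
  "untwisted x (y + z) = untwisted x y + untwisted x z"
  "untwisted x (scale c z) = scale c (untwisted x z)"
  using untw.linear_left[of z] untw.linear_right[of x] by (auto simp: linear_on_def)

sublocale untw_left: additive "\<lambda>x. untwisted x y" for y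
  by unfold_locales (simp add: untwisted_linear)

sublocale untw_right: additive "\<lambda>y. untwisted x y" for x
  by unfold_locales (simp add: untwisted_linear)

sublocale twist: additive \<sigma>
  by unfold_locales (simp add: twist_add)

lemma untwisted_swap: "untwisted y x = - untwisted x y"
  using untw.bracket_self[of "x + y"] untw.bracket_self[of x] untw.bracket_self[of y]
  by (simp add: untwisted_linear eq_neg_iff_add_eq_0 add.commute)

text \<open>Reduces a claim about all products with \<open>x\<close> to a spanning set. With
  \<open>V = {0}\<close> it tests whether products vanish.\<close>

lemma subspace_untwisted_vimage:
  assumes "subspace V"
  shows "subspace {y. untwisted x y \<in> V}"
  using assms
  by (auto intro!: subspaceI
      simp: untwisted_linear untw_right.zero subspace_0 subspace_add subspace_scale)

section \<open>Ideals of the untwisted Lie algebra\<close>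

abbreviation ideal :: "'a set \<Rightarrow> bool" where
  "ideal \<equiv> untw.algebra_ideal"

lemma ideal_def: "ideal I \<longleftrightarrow> subspace I \<and> (\<forall>x\<in>I. \<forall>y. untwisted x y \<in> I)"
  by (simp add: untw.algebra_ideal_def)

lemma ideal_commute: "ideal I \<Longrightarrow> x \<in> I \<Longrightarrow> untwisted y x \<in> I"
  using untwisted_swap[of y x] by (auto simp: ideal_def subspace_neg)

lemma ideal_Int: "ideal I \<Longrightarrow> ideal J \<Longrightarrow> ideal (I \<inter> J)"
  by (auto simp: ideal_def subspace_inter)

lemma ideal_span_Union:
  assumes "\<And>I. I \<in> \<I> \<Longrightarrow> ideal I"
  shows "ideal (span (\<Union>\<I>))"
proof -
  have "untwisted x y \<in> span (\<Union>\<I>)" if "x \<in> span (\<Union>\<I>)" for x y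
  proof -
    have "\<Union>\<I> \<subseteq> {x. untwisted y x \<in> span (\<Union>\<I>)}"
      using assms by (auto intro!: span_base dest: ideal_commute)
    then have "span (\<Union>\<I>) \<subseteq> {x. untwisted y x \<in> span (\<Union>\<I>)}"
      by (intro span_minimal subspace_untwisted_vimage) auto
    then show ?thesis
      using that untwisted_swap[of x y] by (auto simp: span_neg)
  qed
  then show ?thesis by (simp add: ideal_def)
qed

text \<open>As \<open>bracket\<close> is \<open>\<sigma>\<close> applied to
  \<open>untwisted\<close>, stability turns absorption for \<open>untwisted\<close> into absorption
  for \<open>bracket\<close>. This is how simplicity of the Hom-Lie algebra enters.\<close>

lemma stable_ideal_trivial:
  assumes "ideal I" "\<sigma> ` I \<subseteq> I"
  shows "I = {0} \<or> I = UNIV"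
proof -
  have "bracket x y \<in> I" if "x \<in> I" for x y
    using assms that by (auto simp: ideal_def simp flip: twist_untwisted)
  then show ?thesis
    using assms hom_ideal_trivial[of I]
    by (simp add: hom_ideal_def algebra_ideal_def ideal_def)
qed

lemma obtain_noncommuting: obtains x y where "untwisted x y \<noteq> 0"
  using not_abelian twist.zero by (metis abelian_def twist_untwisted)

text \<open>The centre \<open>Z\<close> is an ideal; it is \<open>\<sigma>\<close>-stable because
  every \<open>y\<close> is the image of \<open>inv \<sigma> y\<close> under the automorphism
  \<open>\<sigma>\<close>, and proper because the product is nonzero.\<close>

lemma central_eq_0:
  assumes "\<And>y. untwisted x y = 0"
  shows "x = 0"
proof -
  define Z where "Z = {x. \<forall>y. untwisted x y = 0}"
  have "ideal Z"
    by (auto simp: ideal_def Z_def untwisted_linear untw_left.zero intro!: subspaceI)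
  moreover have "\<sigma> ` Z \<subseteq> Z"
  proof clarify
    fix z assume z: "z \<in> Z"
    have "untwisted (\<sigma> z) y = \<sigma> (untwisted z (inv \<sigma> y))" for y
      using twist_automorphism_untwisted bij_twist
      by (simp add: algebra_iso_def bij_is_surj surj_f_inv_f)
    then show "\<sigma> z \<in> Z" using z by (simp add: Z_def twist.zero)
  qed
  moreover have "Z \<noteq> UNIV"
    using obtain_noncommuting by (metis (mono_tags) UNIV_I Z_def mem_Collect_eq)
  ultimately have "Z = {0}" using stable_ideal_trivial by blast
  then show ?thesis using assms by (auto simp: Z_def)
qed

end

section \<open>Translates of a minimal ideal\<close>

locale minimal_ideal_hom_lie_algebra = simple_regular_hom_lie_algebra scale bracket \<sigma>
  for scale :: "'f::field \<Rightarrow> 'a::ab_group_add \<Rightarrow> 'a" and bracket \<sigma> +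
  fixes M :: "'a set"
  assumes ideal_M: "ideal M" and M_nonzero: "M \<noteq> {0}"
    and M_minimal: "ideal J \<Longrightarrow> J \<subseteq> M \<Longrightarrow> J = {0} \<or> J = M"
begin

text \<open>An infinite sequence in which members may repeat; a range of indices without repetition
  is chosen only once a period is known.\<close>

definition S :: "nat \<Rightarrow> 'a set" where
  "S k = (\<sigma> ^^ k) ` M"

lemma funpow_automorphism: "algebra_iso scale UNIV untwisted UNIV untwisted (\<sigma> ^^ k)"
  by (rule algebra_iso_funpow[OF twist_automorphism_untwisted])

lemma bij_funpow: "bij (\<sigma> ^^ k)"
  using funpow_automorphism by (simp add: algebra_iso_def)

lemma S_0: "S 0 = M"
  by (simp add: S_def)

lemma S_add: "S (j + k) = (\<sigma> ^^ j) ` S k"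
  by (simp add: S_def funpow_add image_comp)

lemma S_Suc: "S (Suc k) = \<sigma> ` S k"
  using S_add[of 1 k] by simp

lemma ideal_automorphic_image:
  assumes "algebra_iso scale UNIV untwisted UNIV untwisted f" "ideal I"
  shows "ideal (f ` I)"
proof -
  have add: "\<And>x y. f (x + y) = f x + f y" and scl: "\<And>c x. f (scale c x) = scale c (f x)"
    and hom: "\<And>x y. f (untwisted x y) = untwisted (f x) (f y)" and bij: "bij f"
    using assms(1) by (auto simp: algebra_iso_def linear_on_def)
  have "f 0 = 0" using add[of 0 0] by simp
  then have "subspace (f ` I)"
    using assms(2) unfolding ideal_def subspace_def
    by (auto simp flip: add scl)
  moreover have "untwisted (f x) y \<in> f ` I" if "x \<in> I" for x y
  proof -
    have "untwisted (f x) y = f (untwisted x (inv f y))"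
      using bij by (simp add: hom bij_is_surj surj_f_inv_f)
    then show ?thesis using assms(2) that by (auto simp: ideal_def)
  qed
  ultimately show ?thesis by (auto simp: ideal_def)
qed

lemma ideal_S: "ideal (S k)"
  unfolding S_def by (rule ideal_automorphic_image[OF funpow_automorphism ideal_M])

text \<open>The inverse automorphism carries an ideal inside \<open>S k\<close> to an ideal inside
  \<open>M\<close>, where minimality is assumed.\<close>

lemma S_minimal:
  assumes "ideal J" "J \<subseteq> S k"
  shows "J = {0} \<or> J = S k"
proof -
  let ?f = "\<sigma> ^^ k"
  let ?J = "inv ?f ` J"
  have inv_aut: "algebra_iso scale UNIV untwisted UNIV untwisted (inv ?f)"
    using algebra_iso_inv_into[OF funpow_automorphism] untw.anticommutative_algebra_axioms .
  have fJ: "?f ` ?J = J"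
    using bij_funpow by (simp add: bij_is_surj image_f_inv_f)
  have f0: "?f 0 = 0"
    by (induction k) (simp_all add: twist.zero)
  have "?J \<subseteq> M"
    using assms(2) bij_funpow by (auto simp: S_def bij_is_inj)
  then have "?J = {0} \<or> ?J = M"
    using ideal_automorphic_image[OF inv_aut assms(1)] M_minimal by blast
  then show ?thesis
    using fJ f0 by (auto simp: S_def)
qed

text \<open>Products lie in the intersection, an ideal. If it were nonzero, minimality of both
  translates would make it equal to each of them.\<close>

lemma S_commute:
  assumes "S j \<noteq> S k" "x \<in> S j" "y \<in> S k"
  shows "untwisted x y = 0"
proof -
  have "ideal (S j \<inter> S k)" by (intro ideal_Int ideal_S)
  then have "S j \<inter> S k = {0}"
    using assms(1) S_minimal[of "S j \<inter> S k" j] S_minimal[of "S j \<inter> S k" k] by auto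
  moreover have "untwisted x y \<in> S j \<inter> S k"
    using assms ideal_S ideal_commute[OF ideal_S] by (auto simp: ideal_def)
  ultimately show ?thesis by auto
qed

text \<open>Shifting \<open>k\<close> to \<open>Suc k\<close> shows that the span is
  \<open>\<sigma>\<close>-stable, and it is nonzero because it contains \<open>M\<close>.\<close>

lemma span_Union_S: "span (\<Union>k. S k) = UNIV"
proof -
  let ?K = "span (\<Union>k. S k)"
  have "ideal ?K"
    by (rule ideal_span_Union) (auto simp: ideal_S)
  moreover have "\<sigma> ` ?K \<subseteq> ?K"
  proof -
    have "module_hom scale scale \<sigma>"
      by unfold_locales (simp_all add: twist_add twist_scale)
    then have "\<sigma> ` ?K = span (\<Union>k. S (Suc k))"
      by (simp add: module_hom.span_image[symmetric] image_UN S_Suc)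
    also have "\<dots> \<subseteq> ?K"
      by (intro span_mono) blast
    finally show ?thesis .
  qed
  moreover have "\<not> ?K \<subseteq> {0}"
  proof -
    have "M \<subseteq> ?K" using S_0 by (metis UNIV_I UN_upper span_superset subset_trans)
    moreover have "0 \<in> M" using ideal_M by (simp add: ideal_def subspace_0)
    ultimately show ?thesis using M_nonzero by auto
  qed
  ultimately show ?thesis using stable_ideal_trivial[of ?K] by auto
qed

section \<open>Consequences of the trivial centre: simplicity and independence\<close>

lemma subspace_containing_S:
  assumes "subspace V" "\<And>k. S k \<subseteq> V"
  shows "x \<in> V"
  using span_minimal[of "\<Union>k. S k" V] assms span_Union_S by auto

lemma central_in_S:
  assumes "\<And>k y. y \<in> S k \<Longrightarrow> untwisted x y = 0"
  shows "x = 0"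
proof (rule central_eq_0)
  fix y
  have "y \<in> {y. untwisted x y \<in> {0}}"
    by (rule subspace_containing_S, rule subspace_untwisted_vimage)
       (use assms in auto)
  then show "untwisted x y = 0" by simp
qed

text \<open>If \<open>M\<close> commuted with itself it would commute with every translate, equal to
  \<open>M\<close> or not, and so be central.\<close>

lemma M_not_abelian: obtains x y where "x \<in> M" "y \<in> M" "untwisted x y \<noteq> 0"
proof -
  have "\<exists>x\<in>M. \<exists>y\<in>M. untwisted x y \<noteq> 0"
  proof (rule ccontr)
    assume "\<not> ?thesis"
    then have "untwisted x y = 0" if "x \<in> M" "y \<in> S k" for x y k
      using that S_commute[of 0 k x y] S_0 by metis
    then have "M \<subseteq> {0}" using central_in_S by auto
    then show False using M_nonzero ideal_M by (auto simp: ideal_def subspace_0)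
  qed
  then show ?thesis using that by blast
qed

text \<open>Translates other than \<open>M\<close> annihilate \<open>M\<close>, and all translates
  together span, so an ideal of \<open>M\<close> is an ideal of the whole algebra and minimality
  applies.\<close>

lemma simple_M: "simple_lie_algebra scale M untwisted"
proof -
  interpret M: lie_algebra scale M untwisted
    by (rule untw.lie_algebra_ideal[OF ideal_M])
  show ?thesis
  proof unfold_locales
    show "\<not> M.abelian"
      using M_not_abelian by (metis M.abelian_def)
  next
    fix J assume J: "M.algebra_ideal J"
    then have sub: "subspace J" "J \<subseteq> M" by (auto simp: M.algebra_ideal_def)
    have "untwisted x y \<in> J" if "x \<in> J" for x y
    proof -
      have "S k \<subseteq> {y. untwisted x y \<in> J}" for k
      proof (cases "S k = M")
        case True
        then show ?thesis using J that by (auto simp: M.algebra_ideal_def)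
      next
        case False
        then show ?thesis
          using S_commute[of 0 k x] S_0 sub that by (auto simp: subspace_0)
      qed
      then have "y \<in> {y. untwisted x y \<in> J}"
        using subspace_containing_S subspace_untwisted_vimage[OF sub(1)] by blast
      then show ?thesis by simp
    qed
    then have "ideal J" using sub by (simp add: ideal_def)
    then show "J = {0} \<or> J = M" using M_minimal sub by blast
  qed
qed

text \<open>Everything in the span of the other translates commutes with \<open>S k\<close>, so
  inclusion would make \<open>S k\<close> abelian, and with it \<open>M\<close> through the
  automorphism \<open>\<sigma> ^^ k\<close>.\<close>

lemma S_not_subset_span:
  assumes "\<And>j. j \<in> I \<Longrightarrow> S j \<noteq> S k"
  shows "\<not> S k \<subseteq> span (\<Union>j\<in>I. S j)"
proof
  assume sub: "S k \<subseteq> span (\<Union>j\<in>I. S j)"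
  have comm: "untwisted x y = 0" if "x \<in> S k" "y \<in> S k" for x y
  proof -
    have "(\<Union>j\<in>I. S j) \<subseteq> {y. untwisted x y \<in> {0}}"
      using that assms S_commute by blast
    then have "span (\<Union>j\<in>I. S j) \<subseteq> {y. untwisted x y \<in> {0}}"
      by (intro span_minimal subspace_untwisted_vimage) auto
    then show ?thesis using sub that by auto
  qed
  obtain x y where xy: "x \<in> M" "y \<in> M" "untwisted x y \<noteq> 0"
    by (rule M_not_abelian)
  have "(\<sigma> ^^ k) (untwisted x y) = untwisted ((\<sigma> ^^ k) x) ((\<sigma> ^^ k) y)"
    using funpow_automorphism by (auto simp: algebra_iso_def)
  also have "\<dots> = 0" using xy by (intro comm) (auto simp: S_def)
  also have "0 = (\<sigma> ^^ k) 0" by (induction k) (simp_all add: twist.zero)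
  finally show False using xy(3) bij_funpow by (metis bij_is_inj inj_eq)
qed

text \<open>Multiplying the relation by an element of \<open>S j\<close> kills every term but the
  one at \<open>j\<close>, so that term vanishes too. Each \<open>d i\<close> thus commutes with all
  translates.\<close>

lemma S_indep:
  assumes inj: "inj_on S I" and fin: "finite I" and all: "(\<Union>i\<in>I. S i) = (\<Union>k. S k)"
    and d: "\<And>i. i \<in> I \<Longrightarrow> d i \<in> S i" and sum: "(\<Sum>i\<in>I. d i) = 0" and i: "i \<in> I"
  shows "d i = 0"
proof (rule central_in_S)
  fix k y assume "y \<in> S k"
  then obtain j where j: "j \<in> I" "y \<in> S j" using all by blast
  have "untwisted (d l) y = 0" if "l \<in> I" "l \<noteq> j" for l
    using that j d inj by (intro S_commute[of l j]) (auto simp: inj_on_def)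
  then have "(\<Sum>i\<in>I. untwisted (d i) y) = untwisted (d j) y"
    using fin j by (simp add: sum.remove[of I j])
  then have "untwisted (\<Sum>i\<in>I. d i) y = untwisted (d j) y"
    by (simp only: untw_left.sum)
  then have "untwisted (d j) y = 0" by (simp add: sum untw_left.zero)
  then show "untwisted (d i) y = 0"
    using i \<open>\<And>l. l \<in> I \<Longrightarrow> l \<noteq> j \<Longrightarrow> untwisted (d l) y = 0\<close> by metis
qed

end

section \<open>Finite dimension\<close>

locale finite_dimensional_simple_regular_hom_lie_algebra =
  finite_dimensional_vector_space scale Basis + simple_regular_hom_lie_algebra scale bracket \<sigma>
  for scale :: "'f::field \<Rightarrow> 'a::ab_group_add \<Rightarrow> 'a" and Basis bracket \<sigma>
begin

text \<open>A nonzero ideal of least dimension works: any nonzero ideal inside it has the same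
  dimension and hence equals it.\<close>

lemma exists_minimal_ideal:
  obtains M where "minimal_ideal_hom_lie_algebra scale bracket \<sigma> M"
proof -
  let ?P = "\<lambda>I. ideal I \<and> I \<noteq> {0}"
  have "?P UNIV"
    using obtain_noncommuting by (metis (full_types) UNIV_I ideal_def singletonD
        subspace_UNIV)
  then obtain M where M: "?P M" "\<And>J. ?P J \<Longrightarrow> dim M \<le> dim J"
    using ex_has_least_nat[of ?P UNIV dim] by blast
  have "J = {0} \<or> J = M" if "ideal J" "J \<subseteq> M" for J
    using subspace_dim_equal[of J M] M that by (auto simp: ideal_def)
  then show ?thesis
    using M by (intro that) (unfold_locales, auto)
qed

end

locale finite_dimensional_minimal_ideal_hom_lie_algebra =
  finite_dimensional_vector_space scale Basis + minimal_ideal_hom_lie_algebra scale bracket \<sigma> M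
  for scale :: "'f::field \<Rightarrow> 'a::ab_group_add \<Rightarrow> 'a" and Basis bracket \<sigma> M
begin

text \<open>If all translates differed, each would enlarge the span of its predecessors, so
  dimensions would grow without bound.\<close>

lemma S_not_inj: "\<not> inj S"
proof
  assume inj: "inj S"
  let ?T = "\<lambda>k. \<Union>j\<in>{..<k}. S j"
  have "k \<le> dim (?T k)" for k
  proof (induction k)
    case (Suc k)
    have "\<not> S k \<subseteq> span (?T k)"
      by (rule S_not_subset_span) (use inj in \<open>auto dest: injD\<close>)
    moreover have "S k \<subseteq> span (?T (Suc k))"
      by (intro subset_trans[OF _ span_superset]) auto
    moreover have "span (?T k) \<subseteq> span (?T (Suc k))"
      by (intro span_mono UN_mono) auto
    ultimately have "span (?T k) \<subset> span (?T (Suc k))" by blast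
    then have "dim (?T k) < dim (?T (Suc k))" by (rule dim_psubset)
    then show ?case using Suc by linarith
  qed simp
  then have "Suc dimension \<le> dimension"
    using dim_subset_UNIV le_trans by blast
  then show False by simp
qed

lemma exists_period:
  obtains n where "n \<ge> 1" "S n = M" "inj_on S {1..n}" "(\<Union>i\<in>{1..n}. S i) = (\<Union>k. S k)"
proof -
  \<comment> \<open>Injectivity of \<open>\<sigma> ^^ j\<close> moves any repetition back to a
    return to \<open>M\<close>, so the least positive \<open>n\<close> with \<open>S n = M\<close>
    is the period.\<close>
  have cancel: "S k = M" if "S (j + k) = S j" for j k
    using that S_add[of j 0] S_add[of j k] S_0 bij_funpow[of j]
    by (simp add: bij_is_inj inj_image_eq_iff)
  have "\<exists>n. n \<ge> 1 \<and> S n = M"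
  proof -
    obtain j k where "j < k" "S j = S k"
      using S_not_inj by (metis injI linorder_neqE_nat)
    then show ?thesis using cancel[of j "k - j"] by (intro exI[of _ "k - j"]) auto
  qed
  then obtain n where n: "n \<ge> 1" "S n = M" and least: "\<And>m. m < n \<Longrightarrow> \<not> (m \<ge> 1 \<and> S m = M)"
    using exists_least_iff[of "\<lambda>n. n \<ge> 1 \<and> S n = M"] by blast
  \<comment> \<open>A coincidence would give a return to \<open>M\<close> after \<open>j - i\<close>
    steps, with \<open>j - i\<close> positive and below \<open>n\<close>.\<close>
  have "S i \<noteq> S j" if "i < j" "i \<in> {1..n}" "j \<in> {1..n}" for i j
    using cancel[of i "j - i"] least[of "j - i"] that by auto
  then have "inj_on S {1..n}"
    by (metis inj_onI linorder_neqE_nat)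
  moreover have "\<exists>i\<in>{1..n}. S k = S i" for k
  proof (induction k)
    case 0
    then show ?case using n S_0 by auto
  next
    case (Suc k)
    then obtain i where i: "i \<in> {1..n}" "S k = S i" by blast
    show ?case
    proof (cases "i = n")
      case True
      then have "S (Suc k) = S 1" using i n S_0 S_Suc[of 0] by (simp add: S_Suc)
      then show ?thesis using n by auto
    next
      case False
      then show ?thesis using i by (intro bexI[of _ "Suc i"]) (auto simp: S_Suc)
    qed
  qed
  then have "(\<Union>i\<in>{1..n}. S i) = (\<Union>k. S k)" by blast
  ultimately show ?thesis using n that by blast
qed

end

section \<open>Assembly of the decomposition from one period of translates\<close>

theorem theorem4p6:
  fixes scale :: "'f::field \<Rightarrow> 'a::ab_group_add \<Rightarrow> 'a"
    and Basis :: "'a set"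
    and bracket :: "'a \<Rightarrow> 'a \<Rightarrow> 'a"
    and \<sigma> :: "'a \<Rightarrow> 'a"
  assumes "finite_dimensional_vector_space scale Basis"
    and "regular_hom_lie_algebra scale UNIV bracket \<sigma>"
    and "simple_hom_lie_algebra scale UNIV bracket \<sigma>"
  shows "\<exists>(n::nat) (\<s> :: 'a set) (br\<s> :: 'a \<Rightarrow> 'a \<Rightarrow> 'a)
           (S :: nat \<Rightarrow> 'a set) (br :: nat \<Rightarrow> 'a \<Rightarrow> 'a \<Rightarrow> 'a)
           (\<phi> :: nat \<Rightarrow> 'a \<Rightarrow> 'a) (\<rho> :: nat \<Rightarrow> nat).
      n \<ge> 1 \<and>
      simple_lie_algebra scale \<s> br\<s> \<and>
      is_direct_sum scale {1..n} S UNIV \<and>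
      (\<forall>i\<in>{1..n}. lie_algebra scale (S i) (br i)) \<and>
      (\<forall>i\<in>{1..n}. algebra_iso scale (S i) (br i) \<s> br\<s> (\<phi> i)) \<and>
      (\<forall>x y. bracket x y = \<sigma> (direct_sum_bracket {1..n} S br x y)) \<and>
      \<rho> permutes {1..n} \<and> cyclic_on \<rho> {1..n} \<and>
      \<sigma> = direct_sum_map {1..n} S (\<lambda>i. restrict \<sigma> (S i)) \<and>
      (\<forall>i\<in>{1..n}. algebra_iso scale (S i) (br i) (S (\<rho> i)) (br (\<rho> i)) (restrict \<sigma> (S i))) \<and>
      (\<forall>i\<in>{1..n}. algebra_iso scale \<s> br\<s> \<s> br\<s> (\<phi> (\<rho> i) \<circ> \<sigma> \<circ> inv_into (S i) (\<phi> i)))"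
proof -
  interpret finite_dimensional_vector_space scale Basis by fact
  interpret regular_hom_lie_algebra scale UNIV bracket \<sigma> by fact
  interpret simple_hom_lie_algebra scale UNIV bracket \<sigma> by fact
  interpret finite_dimensional_simple_regular_hom_lie_algebra scale Basis bracket \<sigma> ..
  obtain M where "minimal_ideal_hom_lie_algebra scale bracket \<sigma> M"
    by (rule exists_minimal_ideal)
  then interpret minimal_ideal_hom_lie_algebra scale bracket \<sigma> M .
  interpret finite_dimensional_minimal_ideal_hom_lie_algebra scale Basis bracket \<sigma> M ..
  obtain n where n: "n \<ge> 1" "S n = M" "inj_on S {1..n}" "(\<Union>i\<in>{1..n}. S i) = (\<Union>k. S k)"
    by (rule exists_period)
  \<comment> \<open>\<open>\<sigma>\<close> sends \<open>S i\<close> to \<open>S (Suc i)\<close>; at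
    \<open>i = n\<close> the equality \<open>S n = M = S 0\<close> makes the image
    \<open>S 1\<close>.\<close>
  define \<rho> where "\<rho> = (\<lambda>i. if i \<in> {1..<n} then Suc i else if i = n then 1 else i)"
  \<comment> \<open>The common model is \<open>M\<close> with \<open>untwisted\<close>; undoing
    \<open>i\<close> applications of \<open>\<sigma>\<close> identifies \<open>S i\<close> with
    it.\<close>
  define \<phi> where "\<phi> = (\<lambda>i. inv (\<sigma> ^^ i))"
  have S_\<rho>: "\<sigma> ` S i = S (\<rho> i)" if "i \<in> {1..n}" for i
    using that n(1,2) S_0 S_Suc[of i] S_Suc[of 0] by (auto simp: \<rho>_def)
  have \<rho>: "\<rho> permutes {1..n}" "cyclic_on \<rho> {1..n}"
    unfolding \<rho>_def by (rule cyclic_permutation_atLeastAtMost[OF n(1)])+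
  have lie: "lie_algebra scale (S i) untwisted" for i
    by (rule untw.lie_algebra_ideal[OF ideal_S])
  then have alg: "anticommutative_algebra scale (S i) untwisted" for i
    by (rule lie_algebra.axioms)
  have sum: "is_direct_sum scale {1..n} S UNIV"
  proof (rule is_direct_sumI)
    show "subspace (S i)" for i using ideal_S by (simp add: ideal_def)
    show "span (\<Union>i\<in>{1..n}. S i) = UNIV" by (simp only: n(4) span_Union_S)
  qed (simp, rule S_indep[OF n(3) _ n(4)], auto)
  note comp = component_mem_sum[OF sum]
  have \<phi>_iso: "algebra_iso scale (S i) untwisted M untwisted (\<phi> i)" for i
  proof -
    have "algebra_iso scale UNIV untwisted UNIV untwisted (\<phi> i)"
      unfolding \<phi>_def
      using algebra_iso_inv_into[OF funpow_automorphism] untw.anticommutative_algebra_axioms .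
    moreover have "\<phi> i ` S i = M"
      using bij_funpow[of i] by (simp add: \<phi>_def S_def image_inv_f_f bij_is_inj)
    ultimately show ?thesis using algebra_iso_image[of scale untwisted "\<phi> i" "S i"] by simp
  qed
  have \<sigma>_iso: "algebra_iso scale (S i) untwisted (S (\<rho> i)) untwisted \<sigma>" if "i \<in> {1..n}" for i
    using algebra_iso_image[OF twist_automorphism_untwisted, of "S i"] S_\<rho>[OF that] by simp
  \<comment> \<open>Both arguments are expanded into components; cross terms vanish because distinct
    translates commute, which leaves the diagonal.\<close>
  have "untwisted x y = direct_sum_bracket {1..n} S (\<lambda>_. untwisted) x y" for x y
  proof -
    let ?x = "\<lambda>i. component {1..n} S i x" and ?y = "\<lambda>i. component {1..n} S i y"
    have "untwisted (?x i) (?y j) = 0" if "i \<in> {1..n}" "j \<in> {1..n}" "i \<noteq> j" for i j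
      using S_commute[OF _ comp(1)[OF that(1)] comp(1)[OF that(2)]] that
      by (simp only: inj_on_eq_iff[OF n(3) that(1,2)] not_False_eq_True)
    then have "(\<Sum>j\<in>{1..n} - {i}. untwisted (?x i) (?y j)) = 0" if "i \<in> {1..n}" for i
      using that by (intro sum.neutral) blast
    then have diag: "(\<Sum>j\<in>{1..n}. untwisted (?x i) (?y j)) = untwisted (?x i) (?y i)"
      if "i \<in> {1..n}" for i
      by (simp only: sum.remove[OF finite_atLeastAtMost that] add_0_right that)
    have "untwisted x y = untwisted (\<Sum>i\<in>{1..n}. ?x i) (\<Sum>j\<in>{1..n}. ?y j)"
      by (simp only: comp(2))
    also have "\<dots> = (\<Sum>i\<in>{1..n}. \<Sum>j\<in>{1..n}. untwisted (?x i) (?y j))"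
      by (subst untw_left.sum) (simp only: untw_right.sum)
    also have "\<dots> = direct_sum_bracket {1..n} S (\<lambda>_. untwisted) x y"
      unfolding direct_sum_bracket_def by (intro sum.cong refl diag)
    finally show ?thesis .
  qed
  then have bracket_eq: "bracket x y = \<sigma> (direct_sum_bracket {1..n} S (\<lambda>_. untwisted) x y)" for x y
    by (metis twist_untwisted)
  have twist_eq: "\<sigma> = direct_sum_map {1..n} S (\<lambda>i. restrict \<sigma> (S i))"
  proof
    fix x
    have "\<sigma> x = \<sigma> (\<Sum>i\<in>{1..n}. component {1..n} S i x)"
      by (simp only: comp(2))
    also have "\<dots> = direct_sum_map {1..n} S (\<lambda>i. restrict \<sigma> (S i)) x"
      unfolding direct_sum_map_def twist.sum by (intro sum.cong refl) (simp only: restrict_apply comp(1) if_True)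
    finally show "\<sigma> x = direct_sum_map {1..n} S (\<lambda>i. restrict \<sigma> (S i)) x" .
  qed
  have restrict_iso: "algebra_iso scale (S i) untwisted (S (\<rho> i)) untwisted (restrict \<sigma> (S i))"
    if "i \<in> {1..n}" for i
    by (rule algebra_iso_cong[OF \<sigma>_iso[OF that] _ alg]) simp
  \<comment> \<open>The composite runs from \<open>M\<close> through \<open>S i\<close> and
    \<open>S (\<rho> i)\<close> back to \<open>M\<close>. On \<open>M\<close> it is the identity for
    \<open>i < n\<close> and \<open>\<sigma> ^^ n\<close> for \<open>i = n\<close>.\<close>
  have "algebra_iso scale M untwisted M untwisted (\<phi> (\<rho> i) \<circ> \<sigma> \<circ> inv_into (S i) (\<phi> i))"
    if "i \<in> {1..n}" for i
    by (intro algebra_iso_comp[OF algebra_iso_inv_into[OF \<phi>_iso alg]]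
        algebra_iso_comp[OF \<sigma>_iso[OF that]] \<phi>_iso)
  then show ?thesis
    using n(1) simple_M sum lie \<phi>_iso bracket_eq \<rho> twist_eq restrict_iso
    by (intro exI[of _ n] exI[of _ M] exI[of _ untwisted] exI[of _ S]
        exI[of _ "\<lambda>_. untwisted"] exI[of _ \<phi>] exI[of _ \<rho>]) (intro conjI ballI allI; blast)
qed

end
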